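(* Let $m,n$ be positive integers. Let $A_0\in S_{m,n}$, let $\mathcal{W}$ be a linear subspace of $M_{m,n}(\mathbb{R})$, and let $\mathcal{P}=A_0+\mathcal{W}$ be the corresponding affine subspace of $M_{m,n}(\mathbb{R})$. Suppose that $\mathcal{P}\subseteq S_{m,n}$. Then $\dim\mathcal{P}\leq mn-m$. Equality holds if and only if there exist $x\in\mathbb{R}_+^n$ with $x\neq 0$ and $b\in\mathbb{R}_{++}^m$ such that $\mathcal{P}=\{A\in M_{m,n}(\mathbb{R}): Ax=b\}$.
   Context: $M_{m,n}(\mathbb{R})$ is the space of real $m\times n$ matrices. $\mathbb{R}_+^n=\{x\in\mathbb{R}^n: x_i\geq 0 \text{ for every } i\}$ and $\mathbb{R}_{++}^n=\{x\in\mathbb{R}^n: x_i>0\text{ for every } i\}$. A matrix $A\in M_{m,n}(\mathbb{R})$ is semipositive if there exists $x\in\mathbb{R}_+^n$ such that $Ax\in\mathbb{R}_{++}^m$; $S_{m,n}$ denotes the set of all semipositive matrices in $M_{m,n}(\mathbb{R})$. The dimension of the affine subspace $A_0+\mathcal{W}$ is $\dim\mathcal{W}$. *)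

theory Defs
  imports "HOL-Analysis.Analysis"
begin

(* An m x n real matrix is an element of real^'n^'m, with m = CARD('m) and n = CARD('n);
   index types are nonempty, so m and n are positive. *)

definition nonneg_orthant :: "(real ^ 'n) set" where
  "nonneg_orthant = {x. \<forall>i. 0 \<le> x $ i}"

definition pos_orthant :: "(real ^ 'n) set" where
  "pos_orthant = {x. \<forall>i. 0 < x $ i}"

definition semipositive :: "(real ^ 'n ^ 'm) set" where
  "semipositive = {A. \<exists>x \<in> nonneg_orthant. A *v x \<in> pos_orthant}"

end

theory Submission
  imports Defs
begin

text \<open>
  The proof passes to the dual description of semipositivity along an affine subspace.  Fix a
  nonzero row vector \<open>y \<ge> 0\<close>.  Every \<open>A \<in> A\<^sub>0 + W\<close> is semipositive, so \<open>y A u > 0\<close> for some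
  \<open>u \<ge> 0\<close>; hence the affine space \<open>{y A | A \<in> A\<^sub>0 + W}\<close> of row vectors misses the nonpositive
  orthant.  Farkas' lemma separates the two by a vector \<open>x \<ge> 0\<close>, which must be constant
  on the affine space: \<open>y B x = 0\<close> for all \<open>B \<in> W\<close>, and \<open>y A\<^sub>0 x > 0\<close>
  (lemma \<open>semipositive_translate_certificate\<close>).

  Taking for \<open>y\<close> the \<open>m\<close> unit vectors gives nonzero vectors \<open>x\<^sub>i \<ge> 0\<close> such that the \<open>i\<close>-th row of
  every \<open>B \<in> W\<close> is orthogonal to \<open>x\<^sub>i\<close>.  These are \<open>m\<close> independent linear conditions
  (lemma \<open>dim_rows_orthogonal\<close>), whence the bound.  If the bound is attained, \<open>W\<close> is exactly the
  space cut out by these conditions.  Then take \<open>y = (1, ..., 1)\<close>, and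
  let \<open>x\<close> be the resulting vector.  For each \<open>v\<close> orthogonal to \<open>x\<^sub>i\<close> the matrix whose only nonzero
  row is \<open>v\<close>, in position \<open>i\<close>, lies in \<open>W\<close>, so \<open>x\<close> is orthogonal to \<open>v\<close>.  Hence
  \<open>x\<close> is a positive multiple of every \<open>x\<^sub>i\<close>, and \<open>W\<close> is the space of all \<open>B\<close> with \<open>B x = 0\<close>.
  The converse is the dimension count once more, with all \<open>x\<^sub>i\<close> equal to \<open>x\<close>.
\<close>

section \<open>Separating a point from a finitely generated cone\<close>

text \<open>
  The convex hull of the generators and \<open>0\<close> is a finite intersection of half-spaces.  One of those
  whose boundary passes through \<open>0\<close> must exclude \<open>z\<close>: otherwise a small positive multiple of \<open>z\<close>
  would satisfy all the inequalities, the remaining ones being strict at \<open>0\<close>, and so \<open>z\<close> would be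
  in the cone.  The normal of that half-space is the required functional.
\<close>

lemma Farkas_finite_generators:
  fixes z :: "'a::euclidean_space"
  assumes "finite G" "G \<subseteq> C" "convex_cone C" "z \<notin> C"
  obtains a where "a \<bullet> z > 0" "\<And>g. g \<in> G \<Longrightarrow> a \<bullet> g \<le> 0"
proof -
  define Q where "Q = convex hull (insert 0 G)"
  have "0 \<in> C"
    using assms(3) by (simp add: convex_cone_iff)
  then have "Q \<subseteq> C"
    unfolding Q_def using assms by (intro hull_minimal) (auto simp: convex_cone_def)
  have "polyhedron Q"
    unfolding Q_def using assms(1) by (simp add: polyhedron_convex_hull)
  then obtain F where F: "finite F" "Q = \<Inter>F"
    and half: "\<And>h. h \<in> F \<Longrightarrow> \<exists>a b. h = {x. a \<bullet> x \<le> b}"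
    unfolding polyhedron_def by metis
  obtain a b where ab: "\<And>h. h \<in> F \<Longrightarrow> h = {x. a h \<bullet> x \<le> b h}"
    using half by metis
  have GQ: "insert 0 G \<subseteq> Q"
    unfolding Q_def by (rule hull_subset)
  have in_Q: "a h \<bullet> q \<le> b h" if "h \<in> F" "q \<in> Q" for h q
    using that F(2) ab by blast
  have "\<exists>h\<in>F. b h = 0 \<and> a h \<bullet> z > 0"
  proof (rule ccontr)
    assume contra: "\<not> ?thesis"
    have "\<forall>\<^sub>F e in at_right 0. a h \<bullet> (e *\<^sub>R z) \<le> b h" if h: "h \<in> F" for h
    proof (cases "b h = 0")
      case True
      with contra h have "a h \<bullet> z \<le> 0" by force
      then have "a h \<bullet> (e *\<^sub>R z) \<le> b h" if "e > 0" for e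
        using True that by (simp add: mult_nonneg_nonpos)
      then show ?thesis
        using eventually_at_right_less by (rule eventually_mono[rotated])
    next
      case False
      moreover have "0 \<le> b h"
        using in_Q[OF h, of 0] GQ by simp
      ultimately have "0 < b h" by simp
      have "((\<lambda>e. a h \<bullet> (e *\<^sub>R z)) \<longlongrightarrow> a h \<bullet> (0 *\<^sub>R z)) (at_right 0)"
        by (intro tendsto_intros)
      then have "\<forall>\<^sub>F e in at_right 0. a h \<bullet> (e *\<^sub>R z) < b h"
        using \<open>0 < b h\<close> by (intro order_tendstoD) auto
      then show ?thesis by (rule eventually_mono) simp
    qed
    then have "\<forall>\<^sub>F e in at_right (0::real). \<forall>h\<in>F. a h \<bullet> (e *\<^sub>R z) \<le> b h"
      using F(1) by (simp add: eventually_ball_finite)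
    then have "\<forall>\<^sub>F e in at_right (0::real). 0 < e \<and> (\<forall>h\<in>F. a h \<bullet> (e *\<^sub>R z) \<le> b h)"
      using eventually_at_right_less by (rule eventually_conj[rotated])
    then obtain e :: real where e: "e > 0" "\<And>h. h \<in> F \<Longrightarrow> a h \<bullet> (e *\<^sub>R z) \<le> b h"
      using eventually_happens'[OF trivial_limit_at_right_real] by blast
    have "e *\<^sub>R z \<in> Q"
      unfolding F(2) using e(2) ab by blast
    then have "inverse e *\<^sub>R (e *\<^sub>R z) \<in> C"
      using \<open>Q \<subseteq> C\<close> e(1) convex_cone_scaleR[OF assms(3), of "inverse e" "e *\<^sub>R z"]
      by (metis inverse_nonnegative_iff_nonnegative less_imp_le subsetD)
    then show False
      using e(1) assms(4) by simp
  qed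
  then obtain h where h: "h \<in> F" "b h = 0" "a h \<bullet> z > 0" by blast
  moreover have "a h \<bullet> g \<le> 0" if "g \<in> G" for g
    using in_Q[OF h(1), of g] GQ that h(2) by auto
  ultimately show thesis using that by blast
qed

text \<open>
  Farkas' lemma is applied to the cone \<open>V + \<real>\<^sub>+\<^sup>n\<close>, generated by a basis of \<open>V\<close>, its negative and the
  unit vectors: \<open>a + V\<close> meets the nonpositive orthant iff this cone contains \<open>- a\<close>.
\<close>

lemma affine_orthant_separation:
  fixes a :: "real ^ 'n"
  assumes V: "subspace V"
    and disj: "\<And>v. v \<in> V \<Longrightarrow> - (a + v) \<notin> nonneg_orthant"
  obtains x where "x \<in> nonneg_orthant" "\<And>v. v \<in> V \<Longrightarrow> v \<bullet> x = 0" "a \<bullet> x > 0"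
proof -
  obtain B where B: "B \<subseteq> V" "independent B" "V \<subseteq> span B"
    using basis_exists[of V] by metis
  define C where "C = {v + p |v p. v \<in> V \<and> p \<in> (nonneg_orthant :: (real ^ 'n) set)}"
  define G where "G = B \<union> uminus ` B \<union> range (\<lambda>i. axis i (1::real))"
  have "finite G"
    unfolding G_def using B(2) by (simp add: finiteI_independent)
  have C_I: "v + p \<in> C" if "v \<in> V" "p \<in> nonneg_orthant" for v p
    unfolding C_def using that by blast
  have V_C: "v \<in> C" if "v \<in> V" for v
    using C_I[OF that, of 0] by (simp add: nonneg_orthant_def)
  have axis_C: "axis i (1::real) \<in> C" for i
    using C_I[OF subspace_0[OF V], of "axis i 1"] by (simp add: nonneg_orthant_def axis_def)
  have "G \<subseteq> C"
    unfolding G_def using B(1) V_C axis_C subspace_neg[OF V] by blast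
  moreover have "convex_cone C"
    unfolding convex_cone_iff
  proof (intro conjI ballI allI impI)
    show "0 \<in> C"
      using V_C subspace_0[OF V] .
  next
    fix s t assume "s \<in> C" "t \<in> C"
    then obtain v p w q where *: "s = v + p" "t = w + q" "v \<in> V" "w \<in> V"
      "p \<in> nonneg_orthant" "q \<in> nonneg_orthant"
      unfolding C_def by blast
    have "s + t = (v + w) + (p + q)" "v + w \<in> V" "p + q \<in> nonneg_orthant"
      using * subspace_add[OF V] by (auto simp: nonneg_orthant_def)
    then show "s + t \<in> C"
      using C_I by simp
  next
    fix s and c :: real assume "s \<in> C" "0 \<le> c"
    then obtain v p where *: "s = v + p" "v \<in> V" "p \<in> nonneg_orthant"
      unfolding C_def by blast
    have "c *\<^sub>R s = c *\<^sub>R v + c *\<^sub>R p" "c *\<^sub>R v \<in> V" "c *\<^sub>R p \<in> nonneg_orthant"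
      using * subspace_scale[OF V] \<open>0 \<le> c\<close>
      by (auto simp: nonneg_orthant_def scaleR_add_right)
    then show "c *\<^sub>R s \<in> C"
      using C_I by simp
  qed
  moreover have "- a \<notin> C"
  proof
    assume "- a \<in> C"
    then obtain v p where *: "- a = v + p" "v \<in> V" "p \<in> nonneg_orthant"
      unfolding C_def by blast
    from *(1) have "- (a + v) = p"
      by (simp add: algebra_simps)
    then show False
      using disj[OF *(2)] *(3) by simp
  qed
  ultimately obtain f where f: "f \<bullet> (- a) > 0" "\<And>g. g \<in> G \<Longrightarrow> f \<bullet> g \<le> 0"
    using Farkas_finite_generators \<open>finite G\<close> by metis
  have ax: "f $ i \<le> 0" for i
    using f(2)[of "axis i 1"] by (simp add: G_def inner_axis)
  have "f \<bullet> g = 0" if "g \<in> B" for g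
    using f(2)[of g] f(2)[of "- g"] that by (force simp: G_def)
  then have "f \<bullet> v = 0" if "v \<in> V" for v
    using orthogonal_to_span[of v B f] that B(3) by (auto simp: orthogonal_def)
  then show thesis
    using that[of "- f"] f(1) ax by (simp add: nonneg_orthant_def inner_commute)
qed

section \<open>Certificates of semipositivity\<close>

lemma inner_nonneg_pos_orthant:
  fixes y :: "real ^ 'm"
  assumes "y \<in> nonneg_orthant" "y \<noteq> 0" "b \<in> pos_orthant"
  shows "y \<bullet> b > 0"
proof -
  obtain k where "y $ k \<noteq> 0"
    using assms(2) by (auto simp: vec_eq_iff)
  then have "0 < y $ k * b $ k"
    using assms by (simp add: nonneg_orthant_def pos_orthant_def less_le)
  then show ?thesis
    unfolding inner_vec_def using assms
    by (intro sum_pos2[where i = k]) (auto simp: nonneg_orthant_def pos_orthant_def less_imp_le)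
qed

text \<open>
  A nonnegative \<open>u\<close> with \<open>A u > 0\<close> shows that \<open>y A\<close> has a positive entry, so the row space
  \<open>y (A\<^sub>0 + W)\<close> avoids the nonpositive orthant and can be separated from it.
\<close>

lemma semipositive_translate_certificate:
  fixes A\<^sub>0 :: "real ^ 'n ^ 'm"
  assumes W: "subspace W"
    and semi: "\<And>B. B \<in> W \<Longrightarrow> A\<^sub>0 + B \<in> semipositive"
    and y: "y \<in> nonneg_orthant" "y \<noteq> 0"
  obtains x where "x \<in> nonneg_orthant"
    "\<And>B. B \<in> W \<Longrightarrow> y \<bullet> (B *v x) = 0" "y \<bullet> (A\<^sub>0 *v x) > 0"
proof -
  have "linear (\<lambda>B :: real ^ 'n ^ 'm. y v* B)"
    by (rule linearI)
       (simp_all add: vec_eq_iff vector_matrix_mult_def algebra_simps sum.distrib sum_distrib_left)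
  then have V: "subspace ((\<lambda>B. y v* B) ` W)"
    using W linear_subspace_image by blast
  have disj: "- (y v* A\<^sub>0 + v) \<notin> nonneg_orthant" if v: "v \<in> (\<lambda>B. y v* B) ` W" for v
  proof
    assume neg: "- (y v* A\<^sub>0 + v) \<in> nonneg_orthant"
    obtain B where B: "B \<in> W" "v = y v* B"
      using v by blast
    then obtain u where u: "u \<in> nonneg_orthant" "(A\<^sub>0 + B) *v u \<in> pos_orthant"
      using semi unfolding semipositive_def by blast
    have "0 < y \<bullet> ((A\<^sub>0 + B) *v u)"
      using inner_nonneg_pos_orthant y u(2) by blast
    also have "\<dots> = (y v* A\<^sub>0 + v) \<bullet> u"
      by (simp add: B(2) dot_lmul_matrix inner_add matrix_vector_mult_add_rdistrib)
    also have "\<dots> \<le> 0"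
    proof -
      have "0 \<le> - (y v* A\<^sub>0 + v) \<bullet> u"
        using neg u(1) unfolding inner_vec_def nonneg_orthant_def
        by (intro sum_nonneg) (simp del: vector_uminus_component)
      then show ?thesis by (simp only: inner_minus_left neg_0_le_iff_le)
    qed
    finally show False by simp
  qed
  obtain x where "x \<in> nonneg_orthant"
    "\<And>v. v \<in> (\<lambda>B. y v* B) ` W \<Longrightarrow> v \<bullet> x = 0" "(y v* A\<^sub>0) \<bullet> x > 0"
    using affine_orthant_separation[OF V disj] by blast
  then show thesis
    using that[of x] by (simp add: ball_simps flip: dot_lmul_matrix)
qed

section \<open>Matrices with prescribed row normals\<close>

lemma subspace_rows_orthogonal:
  fixes x :: "'m::finite \<Rightarrow> real ^ 'n"
  shows "subspace {B :: real ^ 'n ^ 'm. \<forall>i. B $ i \<bullet> x i = 0}"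
  by (rule subspaceI) (simp_all add: inner_add_left)

text \<open>
  The space is the orthogonal complement of the \<open>m\<close> matrices whose only nonzero row is the \<open>i\<close>-th
  one, equal to \<open>x\<^sub>i\<close>; these are pairwise orthogonal.
\<close>

lemma dim_rows_orthogonal:
  fixes x :: "'m::finite \<Rightarrow> real ^ 'n"
  assumes "\<And>i. x i \<noteq> 0"
  shows "dim {B :: real ^ 'n ^ 'm. \<forall>i. B $ i \<bullet> x i = 0} = CARD('m) * CARD('n) - CARD('m)"
proof -
  define E :: "'m \<Rightarrow> real ^ 'n ^ 'm" where "E = (\<lambda>i. axis i (x i))"
  have "inj E"
    unfolding E_def using assms by (intro injI) (metis axis_eq_axis)
  have "pairwise orthogonal (range E)"
    by (auto simp: pairwise_def orthogonal_def E_def inner_axis_axis)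
  moreover have "0 \<notin> range E"
    using assms by (auto simp: E_def axis_eq_0_iff)
  ultimately have "independent (range E)"
    by (rule pairwise_orthogonal_independent)
  then have "dim (span (range E)) = CARD('m)"
    by (simp add: dim_eq_card_independent card_image[OF \<open>inj E\<close>])
  moreover have "dim {B \<in> UNIV. \<forall>M \<in> span (range E). orthogonal M B} + dim (span (range E))
      = dim (UNIV :: (real ^ 'n ^ 'm) set)"
    by (rule dim_subspace_orthogonal_to_vectors) auto
  moreover have "(\<forall>M \<in> span (range E). orthogonal M B) \<longleftrightarrow> (\<forall>i. B $ i \<bullet> x i = 0)" for B
  proof -
    have "orthogonal M B" if "\<forall>i. orthogonal B (E i)" "M \<in> span (range E)" for M
      using orthogonal_to_span[OF that(2), of B] that(1) by (metis orthogonal_commute rangeE)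
    then have "(\<forall>M \<in> span (range E). orthogonal M B) \<longleftrightarrow> (\<forall>i. orthogonal B (E i))"
      using span_base[of _ "range E"] by (auto simp: orthogonal_commute)
    then show ?thesis
      by (simp add: orthogonal_def E_def inner_axis)
  qed
  ultimately show ?thesis
    by simp
qed

lemma orthogonal_to_hyperplane_imp_multiple:
  fixes u x :: "'a::real_inner"
  assumes "u \<noteq> 0" "\<And>v. v \<bullet> u = 0 \<Longrightarrow> v \<bullet> x = 0"
  shows "x = ((x \<bullet> u) / (u \<bullet> u)) *\<^sub>R u"
proof -
  define v where "v = x - ((x \<bullet> u) / (u \<bullet> u)) *\<^sub>R u"
  have "v \<bullet> u = 0"
    using assms(1) by (simp add: v_def inner_diff_left)
  moreover from this have "v \<bullet> x = 0"
    by (rule assms(2))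
  ultimately have "v \<bullet> v = 0"
    by (subst (2) v_def) (simp add: inner_diff_right)
  then show ?thesis
    by (simp add: v_def)
qed

lemma matrix_vector_mult_eq_0_iff_rows:
  fixes B :: "real ^ 'n ^ 'm"
  shows "B *v x = 0 \<longleftrightarrow> (\<forall>i. B $ i \<bullet> x = 0)"
  by (simp add: vec_eq_iff matrix_vector_mul_component)

section \<open>The dimension bound and its extremal case\<close>

theorem theorem3p1:
  fixes A\<^sub>0 :: "real ^ 'n ^ 'm"
    and W P :: "(real ^ 'n ^ 'm) set"
  assumes "A\<^sub>0 \<in> semipositive"
    and "subspace W"
    and "P = (\<lambda>B. A\<^sub>0 + B) ` W"
    and "P \<subseteq> semipositive"
  shows "dim W \<le> CARD('m) * CARD('n) - CARD('m) \<and>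
    (dim W = CARD('m) * CARD('n) - CARD('m) \<longleftrightarrow>
      (\<exists>x \<in> nonneg_orthant. x \<noteq> 0 \<and> (\<exists>b \<in> pos_orthant. P = {A. A *v x = b})))"
proof -
  have semi: "A\<^sub>0 + B \<in> semipositive" if "B \<in> W" for B
    using assms(3,4) that by blast
  have in_P: "A \<in> P \<longleftrightarrow> A - A\<^sub>0 \<in> W" for A
    unfolding assms(3) by (metis (no_types, lifting) add_diff_cancel_left' diff_add_cancel
        add.commute image_iff)
  note certificate = semipositive_translate_certificate[OF assms(2) semi]

  have "\<exists>x. x \<in> nonneg_orthant \<and> (\<forall>B\<in>W. B $ i \<bullet> x = 0) \<and> A\<^sub>0 $ i \<bullet> x > 0" for i
  proof -
    have "axis i 1 \<in> nonneg_orthant" "axis i 1 \<noteq> (0 :: real ^ 'm)"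
      by (auto simp: nonneg_orthant_def axis_def vec_eq_iff)
    then obtain x where "x \<in> nonneg_orthant"
      "\<And>B. B \<in> W \<Longrightarrow> axis i 1 \<bullet> (B *v x) = 0" "axis i 1 \<bullet> (A\<^sub>0 *v x) > 0"
      using certificate by blast
    then show ?thesis
      by (auto simp: inner_axis' matrix_vector_mul_component)
  qed
  then obtain x where x: "\<And>i. x i \<in> nonneg_orthant"
    "\<And>i B. B \<in> W \<Longrightarrow> B $ i \<bullet> x i = 0" "\<And>i. A\<^sub>0 $ i \<bullet> x i > 0"
    by metis
  have x_nz: "x i \<noteq> 0" for i
    using x(3)[of i] by auto
  define T where "T = {B :: real ^ 'n ^ 'm. \<forall>i. B $ i \<bullet> x i = 0}"
  have dim_T: "dim T = CARD('m) * CARD('n) - CARD('m)"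
    unfolding T_def using x_nz by (rule dim_rows_orthogonal)
  have subspace_T: "subspace T"
    unfolding T_def by (rule subspace_rows_orthogonal)
  have "W \<subseteq> T"
    unfolding T_def using x(2) by blast
  then have bound: "dim W \<le> CARD('m) * CARD('n) - CARD('m)"
    using dim_subset dim_T by metis

  have extremal: "\<exists>x \<in> nonneg_orthant. x \<noteq> 0 \<and> (\<exists>b \<in> pos_orthant. P = {A. A *v x = b})"
    if "dim W = CARD('m) * CARD('n) - CARD('m)"
  proof -
    have "W = T"
      using subspace_dim_equal[OF assms(2) subspace_T \<open>W \<subseteq> T\<close>] that dim_T by simp
    have "(\<chi> i. 1) \<in> nonneg_orthant" "(\<chi> i. 1) \<noteq> (0 :: real ^ 'm)"
      by (auto simp: nonneg_orthant_def vec_eq_iff)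
    then obtain z where z: "z \<in> nonneg_orthant"
      "\<And>B. B \<in> W \<Longrightarrow> (\<chi> i. 1) \<bullet> (B *v z) = 0" "(\<chi> i. 1) \<bullet> (A\<^sub>0 *v z) > 0"
      using certificate by blast
    have "z \<noteq> 0"
      using z(3) by auto
    have z_orth: "v \<bullet> z = 0" if "v \<bullet> x i = 0" for i v
    proof -
      \<comment> \<open>the matrix whose only nonzero row is the \<open>i\<close>-th one, equal to \<open>v\<close>\<close>
      have "axis i v \<in> W"
        unfolding \<open>W = T\<close> T_def using that by (simp add: axis_def)
      from z(2)[OF this] have "(\<Sum>k\<in>UNIV. axis i v $ k \<bullet> z) = 0"
        by (simp add: inner_vec_def[of "\<chi> i. 1"] matrix_vector_mul_component)
      moreover have "(\<Sum>k\<in>UNIV. axis i v $ k \<bullet> z) = (\<Sum>k\<in>UNIV. if k = i then v \<bullet> z else 0)"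
        by (intro sum.cong) (auto simp: axis_def)
      ultimately show ?thesis by simp
    qed
    have "\<exists>c>0. z = c *\<^sub>R x i" for i
    proof -
      have eq: "z = ((z \<bullet> x i) / (x i \<bullet> x i)) *\<^sub>R x i"
        using x_nz z_orth by (rule orthogonal_to_hyperplane_imp_multiple)
      have "0 \<le> z \<bullet> x i"
        using z(1) x(1)[of i] by (auto simp: inner_vec_def nonneg_orthant_def intro!: sum_nonneg)
      moreover have "z \<bullet> x i \<noteq> 0"
        using eq \<open>z \<noteq> 0\<close> by (metis div_0 scaleR_zero_left)
      ultimately have "(z \<bullet> x i) / (x i \<bullet> x i) > 0"
        using x_nz by simp
      with eq show ?thesis by blast
    qed
    then obtain c where c: "\<And>i. c i > 0" "\<And>i. z = c i *\<^sub>R x i"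
      by metis
    have row: "B $ i \<bullet> z = c i * (B $ i \<bullet> x i)" for B :: "real ^ 'n ^ 'm" and i
      by (subst c(2)[of i]) simp
    have "B \<in> W \<longleftrightarrow> B *v z = 0" for B
      unfolding \<open>W = T\<close> T_def matrix_vector_mult_eq_0_iff_rows row
      by (simp add: c(1)[THEN less_imp_neq, symmetric])
    then have "P = {A. A *v z = A\<^sub>0 *v z}"
      using in_P by (auto simp: matrix_vector_mult_diff_rdistrib)
    moreover have "A\<^sub>0 *v z \<in> pos_orthant"
      using c(1) x(3) by (simp add: pos_orthant_def matrix_vector_mul_component row)
    ultimately show ?thesis
      using z(1) \<open>z \<noteq> 0\<close> by blast
  qed

  have attained: "dim W = CARD('m) * CARD('n) - CARD('m)"
    if "z \<noteq> 0" "P = {A. A *v z = b}" for z b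
  proof -
    have "A\<^sub>0 \<in> P"
      using in_P subspace_0[OF assms(2)] by simp
    then have "A\<^sub>0 *v z = b"
      using that(2) by simp
    moreover have "B \<in> W \<longleftrightarrow> A\<^sub>0 + B \<in> P" for B
      by (simp add: in_P)
    ultimately have "W = {B. B *v z = 0}"
      using that(2) by (auto simp: matrix_vector_mult_add_rdistrib)
    then show ?thesis
      using dim_rows_orthogonal[where x = "\<lambda>_ :: 'm. z"] that(1)
      by (simp add: matrix_vector_mult_eq_0_iff_rows)
  qed
  show ?thesis
    using bound extremal attained by blast
qed

end
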